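(* Let $r>6$ and $n$ be integers with $3r+3\le n\le r^2$, and put $a=n-2r+1$ and $b=2r-1$. Let $$t=\max\left\{\left\lceil\frac{a}{r-1}\right\rceil-1,\ \left\lceil\frac{a-b}{2}\right\rceil,\ \left\lceil\frac{r+2}{2}\right\rceil\right\}$$ and suppose that $2t\le b$. Let $X=C_a^{\,t}$ be the $t$-th power of the cycle $C_a$ on $a$ vertices. Then: (i) $\alpha(X)\le r-1$; (ii) $\kappa(X)\ge a-b$; (iii) $\Delta(X)\ge r+2$.
   Context: For positive integers $m$ and $k$, the $k$-th power $C_m^{\,k}$ of the cycle $C_m$ is the graph with vertex set $\mathbb{Z}_m=\{0,1,\dots,m-1\}$ in which two distinct vertices $x,y$ are adjacent if and only if $\min\{|x-y|,\,m-|x-y|\}\le k$. $\alpha(X)$ is the maximum size of an independent set of $X$ and $\Delta(X)$ is the maximum degree. A graph is $k$-connected if it has at least $k+1$ vertices and removal of any $k-1$ or fewer vertices leaves a connected graph; $\kappa(X)$ is the largest $k$ for which $X$ is $k$-connected (so $\kappa(K_m)=m-1$). *)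

theory Defs
  imports Complex_Main "Graph_Theory.Graph_Theory"
begin

text \<open>
  Finite simple graphs are the \<^locale>\<open>pair_graph\<close>s of the entry Graph_Theory: finite, loop-free,
  symmetric digraphs whose arcs are ordered pairs, each edge being represented by its two
  orientations. The invariants below are only meaningful for nonempty graphs of this kind.
\<close>

definition independent_set :: "'a pair_pre_digraph \<Rightarrow> 'a set \<Rightarrow> bool" where
  "independent_set G S \<longleftrightarrow> S \<subseteq> pverts G \<and> (\<forall>u\<in>S. \<forall>v\<in>S. (u, v) \<notin> parcs G)"

definition independence_number :: "'a pair_pre_digraph \<Rightarrow> nat" where
  "independence_number G = Max (card ` {S. independent_set G S})"

text \<open>By symmetry of the arc relation, the out-degree of a vertex is its degree.\<close>

definition max_degree :: "'a pair_pre_digraph \<Rightarrow> nat" where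
  "max_degree G = Max (out_degree (with_proj G) ` pverts G)"

text \<open>
  ``At most $k - 1$ vertices'' is written \<open>card S < k\<close> to avoid truncated subtraction; in
  particular every nonempty graph is 0-connected. The qualified name distinguishes graph
  connectedness from the topological notion.
\<close>

definition k_connected :: "nat \<Rightarrow> 'a pair_pre_digraph \<Rightarrow> bool" where
  "k_connected k G \<longleftrightarrow> card (pverts G) \<ge> k + 1 \<and>
     (\<forall>S \<subseteq> pverts G. card S < k \<longrightarrow>
       Digraph_Component.connected (induce_subgraph (with_proj G) (pverts G - S)))"

definition vertex_connectivity :: "'a pair_pre_digraph \<Rightarrow> nat" where
  "vertex_connectivity G = Max {k. k_connected k G}"

definition cycle_power :: "int \<Rightarrow> int \<Rightarrow> int pair_pre_digraph" where
  "cycle_power m k =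
     \<lparr> pverts = {0..<m},
       parcs = {(x, y). x \<in> {0..<m} \<and> y \<in> {0..<m} \<and> x \<noteq> y \<and> min \<bar>x - y\<bar> (m - \<bar>x - y\<bar>) \<le> k} \<rparr>"

lemma pair_graph_cycle_power: "pair_graph (cycle_power m k)"
proof -
  have "finite (parcs (cycle_power m k))"
    by (rule finite_subset[of _ "{0..<m} \<times> {0..<m}"]) (auto simp: cycle_power_def)
  moreover have "sym (parcs (cycle_power m k))"
    by (rule symI) (simp add: cycle_power_def abs_minus_commute)
  ultimately show ?thesis
    by unfold_locales (auto simp: cycle_power_def symmetric_def arcs_ends_def arc_to_ends_def)
qed

lemma independent_set_attains:
  assumes "finite (pverts G)"
  shows "\<exists>S. independent_set G S \<and> card S = independence_number G"
proof -
  have "{S. independent_set G S} \<subseteq> Pow (pverts G)"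
    by (auto simp: independent_set_def)
  then have "finite (card ` {S. independent_set G S})"
    using assms by (meson finite_Pow_iff finite_imageI finite_subset)
  moreover have "independent_set G {}"
    by (simp add: independent_set_def)
  ultimately have "independence_number G \<in> card ` {S. independent_set G S}"
    unfolding independence_number_def by (intro Max_in) auto
  then show ?thesis by auto
qed

lemma finite_k_connected: "finite {k. k_connected k G}"
  by (rule finite_subset[of _ "{..card (pverts G)}"]) (auto simp: k_connected_def)

lemma k_connected_vertex_connectivity:
  assumes "finite (pverts G)" "pverts G \<noteq> {}"
  shows "k_connected (vertex_connectivity G) G"
proof -
  have "k_connected 0 G"
    using assms by (simp add: k_connected_def Suc_le_eq card_gt_0_iff)
  then have "vertex_connectivity G \<in> {k. k_connected k G}"
    unfolding vertex_connectivity_def by (intro Max_in finite_k_connected) auto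
  then show ?thesis by simp
qed

end

theory Submission
  imports Defs
begin

text \<open>
  The bounds on independence number and connectivity rest on one observation about $C_m^{\,t}$:
  integers at distance at most $t$ have residues modulo $m$ that are equal or adjacent
  (\<open>cycle_power_near\<close>). So an argument on the cycle can be carried out on the integer line and
  then reduced modulo $m$.

  \<^item> \<^emph>\<open>Independence.\<close> If $t \ge m$ the graph is complete. Otherwise let $S$ be independent. The
    cyclic blocks $s, s+1, \dots, s+t$ with $s \in S$ have $t+1$ distinct members each and are
    pairwise disjoint, because two overlapping blocks start at distance at most $t$. Hence
    $|S|(t+1) \le m$ (\<open>independent_cycle_power_card_le\<close>). The first term of the maximum that
    defines $t$ gives $a \le (r-1)(t+1)$, so $|S| \le r-1$.

  \<^item> \<^emph>\<open>Connectivity.\<close> To separate $u$ from $v$, both arcs of the cycle between them must contain $t$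
    consecutive deleted vertices: otherwise one can walk along the arc in jumps of length at most
    $t$ (\<open>cycle_power_walk\<close>). That costs $2t$ deletions, so $C_m^{\,t}$ is $k$-connected
    whenever $k \le 2t$ and $k < m$ (\<open>k_connected_cycle_power\<close>). The second term of the maximum
    gives $2t \ge a-b$.

  \<^item> \<^emph>\<open>Degree.\<close> The vertex $0$ has $2t$ neighbours, or all $m-1$ other vertices if these are fewer
    (\<open>max_degree_cycle_power_ge\<close>). The third term of the maximum gives $2t \ge r+2$, while
    $a - 1 \ge r+3$ follows from $n \ge 3r+3$.
\<close>

section \<open>Adjacency modulo the length of the cycle\<close>

lemma pverts_cycle_power [simp]: "pverts (cycle_power m t) = {0..<m}"
  by (simp add: cycle_power_def)

text \<open>
  If the residues of \<open>x\<close> and \<open>y\<close> differ by \<open>d\<close>, then \<open>x - y\<close> is \<open>d\<close> plus a multiple of \<open>m\<close>, and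
  \<open>\<bar>d\<bar> < m\<close>. So \<open>\<bar>x - y\<bar>\<close> is \<open>\<bar>d\<bar>\<close> if the multiple is zero, and at least \<open>m - \<bar>d\<bar>\<close> otherwise.
\<close>
lemma cycle_power_near:
  assumes m: "0 < m" and near: "\<bar>x - y\<bar> \<le> t"
  shows "x mod m = y mod m \<or> (x mod m, y mod m) \<in> parcs (cycle_power m t)"
proof -
  define d where "d = x mod m - y mod m"
  define q where "q = x div m - y div m"
  have bounds: "0 \<le> x mod m" "x mod m < m" "0 \<le> y mod m" "y mod m < m"
    using m by auto
  have "m * (x div m) + x mod m - (m * (y div m) + y mod m) = x - y"
    by simp
  then have diff: "x - y = d + m * q"
    by (simp add: d_def q_def algebra_simps)
  have "min \<bar>d\<bar> (m - \<bar>d\<bar>) \<le> t"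
  proof -
    consider "q = 0" | "1 \<le> q" | "q \<le> -1" by linarith
    then show ?thesis
    proof cases
      case 1
      then show ?thesis using diff near by auto
    next
      case 2
      then have "m * 1 \<le> m * q" using m by (intro mult_left_mono) auto
      then show ?thesis using diff near by linarith
    next
      case 3
      then have "m * q \<le> m * (-1)" using m by (intro mult_left_mono) auto
      then show ?thesis using diff near by linarith
    qed
  qed
  then show ?thesis
    using bounds by (auto simp: cycle_power_def d_def)
qed

section \<open>Independent sets\<close>

text \<open>
  Injectivity of \<open>shift\<close> is the disjointness of the blocks of length \<open>t + 1\<close> that start at the
  elements of \<open>S\<close>: if \<open>s + i\<close> and \<open>s' + i'\<close> agree modulo \<open>m\<close>, then \<open>s\<close> is the residue of
  \<open>s' + i' - i\<close>, which is at distance at most \<open>t\<close> from \<open>s'\<close>.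
\<close>
lemma independent_cycle_power_card_le:
  assumes t: "0 \<le> t" "t < m" and ind: "independent_set (cycle_power m t) S"
  shows "int (card S) * (t + 1) \<le> m"
proof -
  define shift where "shift = (\<lambda>(s, i). (s + i) mod m)"
  have S: "S \<subseteq> {0..<m}" and nonadj: "\<And>u v. u \<in> S \<Longrightarrow> v \<in> S \<Longrightarrow> (u, v) \<notin> parcs (cycle_power m t)"
    using ind by (auto simp: independent_set_def)
  have "inj_on shift (S \<times> {0..t})"
  proof (rule inj_onI, clarify)
    fix s i s' i'
    assume in_S: "s \<in> S" "s' \<in> S" and i: "i \<in> {0..t}" "i' \<in> {0..t}"
      and eq: "shift (s, i) = shift (s', i')"
    have range: "s \<in> {0..<m}" "s' \<in> {0..<m}" using S in_S by auto
    from eq have "(s + i - i) mod m = (s' + i' - i) mod m"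
      unfolding shift_def prod.case by (rule mod_diff_cong) simp
    then have s: "s = (s' + i' - i) mod m" using range by simp
    moreover have "s' mod m = s'" using range by simp
    ultimately have "s = s' \<or> (s, s') \<in> parcs (cycle_power m t)"
      using cycle_power_near[of m "s' + i' - i" s' t] i t by auto
    then have "s = s'" using nonadj in_S by blast
    moreover from this eq have "(s + i - s) mod m = (s + i' - s) mod m"
      unfolding shift_def prod.case by (intro mod_diff_cong) auto
    then have "i = i'" using i t by simp
    ultimately show "s = s' \<and> i = i'" ..
  qed
  moreover have "shift ` (S \<times> {0..t}) \<subseteq> {0..<m}"
    using t by (auto simp: shift_def)
  ultimately have "card (S \<times> {0..t}) \<le> card {0..<m}"
    by (rule card_inj_on_le) simp
  then have "card S * nat (t + 1) \<le> nat m"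
    by (simp add: card_cartesian_product)
  then have "int (card S * nat (t + 1)) \<le> int (nat m)"
    by (simp only: of_nat_le_iff)
  then show ?thesis using t by simp
qed

lemma independent_cycle_power_card_le_1:
  assumes "m \<le> t" and ind: "independent_set (cycle_power m t) S"
  shows "card S \<le> 1"
proof -
  have "finite S"
    using ind by (auto simp: independent_set_def intro: finite_subset)
  moreover have "x = y" if "x \<in> S" "y \<in> S" for x y
    using that assms by (force simp: independent_set_def cycle_power_def)
  ultimately show ?thesis by (simp add: card_le_Suc0_iff_eq)
qed

lemma independence_number_cycle_power_le:
  assumes "0 \<le> t" "1 \<le> c" "m \<le> c * (t + 1)"
  shows "int (independence_number (cycle_power m t)) \<le> c"
proof -
  obtain S where S: "independent_set (cycle_power m t) S"
      "card S = independence_number (cycle_power m t)"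
    using independent_set_attains[of "cycle_power m t"] by auto
  show ?thesis
  proof (cases "t < m")
    case True
    then have "int (card S) * (t + 1) \<le> c * (t + 1)"
      using independent_cycle_power_card_le[OF _ True S(1)] assms by linarith
    then show ?thesis using S(2) assms by simp
  next
    case False
    then show ?thesis
      using independent_cycle_power_card_le_1[OF _ S(1)] S(2) assms by simp
  qed
qed

section \<open>Connectivity\<close>

text \<open>
  The walk is greedy: as long as the target is more than \<open>t\<close> ahead, some vertex among the next \<open>t\<close>
  survives and is adjacent to the present one.
\<close>
lemma cycle_power_walk:
  assumes m: "0 < m" and uv: "u \<le> v"
    and V: "u mod m \<in> V" "v mod m \<in> V"
    and gap: "\<And>x. u \<le> x \<Longrightarrow> x + t < v \<Longrightarrow> \<exists>y\<in>{x<..x + t}. y mod m \<in> V"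
  shows "(u mod m, v mod m) \<in> rtrancl_on V (parcs (cycle_power m t))"
  using uv V(1) gap
proof (induction "nat (v - u)" arbitrary: u rule: less_induct)
  case less
  show ?case
  proof (cases "v - u \<le> t")
    case True
    then have "u mod m = v mod m \<or> (u mod m, v mod m) \<in> parcs (cycle_power m t)"
      using cycle_power_near[OF m] less.prems(1) by simp
    then show ?thesis
      using less.prems(2) V(2) by (auto intro: converse_rtrancl_on_into_rtrancl_on)
  next
    case False
    then obtain y where y: "u < y" "y \<le> u + t" "y mod m \<in> V"
      using less.prems(3)[of u] by auto
    have walk: "(y mod m, v mod m) \<in> rtrancl_on V (parcs (cycle_power m t))"
      by (rule less.hyps) (use y False less.prems in auto)
    have "u mod m = y mod m \<or> (u mod m, y mod m) \<in> parcs (cycle_power m t)"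
      using cycle_power_near[OF m] y by simp
    then show ?thesis
      using walk less.prems(2) by (auto intro: converse_rtrancl_on_into_rtrancl_on)
  qed
qed

text \<open>
  If neither way round the cycle can be walked, then a block of \<open>t\<close> deleted vertices lies strictly
  between \<open>u\<close> and \<open>v\<close> and another one strictly between \<open>v\<close> and \<open>u + m\<close>. The two blocks lie in one
  period, so they stay disjoint modulo \<open>m\<close>.
\<close>
lemma cycle_power_minus_walk:
  assumes t: "0 \<le> t" and S: "S \<subseteq> {0..<m}" "int (card S) < 2 * t"
    and u: "u \<in> {0..<m} - S" and v: "v \<in> {0..<m} - S" and uv: "u \<le> v"
  shows "(u, v) \<in> rtrancl_on ({0..<m} - S) (parcs (cycle_power m t)) \<or>
         (v, u) \<in> rtrancl_on ({0..<m} - S) (parcs (cycle_power m t))"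
proof (rule ccontr)
  let ?R = "rtrancl_on ({0..<m} - S) (parcs (cycle_power m t))"
  assume "\<not> ?thesis"
  then have no_walk: "(u, v) \<notin> ?R" "(v, u) \<notin> ?R" by auto
  have m: "0 < m" using u by auto
  have mods: "u mod m = u" "v mod m = v" using u v by auto
  have block: "\<exists>x\<ge>p. x + t < q \<and> (\<forall>y\<in>{x<..x + t}. y mod m \<in> S)"
    if "p \<le> q" "p mod m \<in> {0..<m} - S" "q mod m \<in> {0..<m} - S"
      "(p mod m, q mod m) \<notin> ?R" for p q
  proof -
    have "\<not> (\<forall>x. p \<le> x \<longrightarrow> x + t < q \<longrightarrow> (\<exists>y\<in>{x<..x + t}. y mod m \<in> {0..<m} - S))"
      using cycle_power_walk[OF m that(1-3)] that(4) by blast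
    moreover have "y mod m \<in> {0..<m}" for y using m by simp
    ultimately show ?thesis by blast
  qed
  obtain x where x: "u \<le> x" "x + t < v" "\<And>y. y \<in> {x<..x + t} \<Longrightarrow> y mod m \<in> S"
    using block[of u v] uv u v no_walk(1) unfolding mods by blast
  \<comment> \<open>Going from \<open>v\<close> to \<open>u\<close> across the point \<open>m\<close> means going up to \<open>u + m\<close> on the line.\<close>
  have "v \<le> u + m" using u v by simp
  moreover have "(u + m) mod m = u" using mods(1) by simp
  ultimately obtain z where z: "v \<le> z" "z + t < u + m"
      "\<And>y. y \<in> {z<..z + t} \<Longrightarrow> y mod m \<in> S"
    using block[of v "u + m"] u v no_walk(2) unfolding mods by metis
  define B where "B = {x<..x + t} \<union> {z<..z + t}"
  have "inj_on (\<lambda>y. y mod m) B"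
  proof (rule inj_onI)
    fix y y' assume in_B: "y \<in> B" "y' \<in> B" and eq: "y mod m = y' mod m"
    have "(y - u) mod m = (y' - u) mod m"
      using eq by (rule mod_diff_cong) simp
    moreover have "0 \<le> y - u" "y - u < m" "0 \<le> y' - u" "y' - u < m"
      using in_B x(1,2) z(1,2) uv unfolding B_def by auto
    ultimately show "y = y'" by simp
  qed
  moreover have "(\<lambda>y. y mod m) ` B \<subseteq> S"
    using x(3) z(3) by (auto simp: B_def)
  moreover have "finite S" using S(1) by (rule finite_subset) simp
  ultimately have "card B \<le> card S" by (rule card_inj_on_le)
  moreover have "card B = nat t + nat t"
    unfolding B_def using x z by (subst card_Un_disjoint) auto
  ultimately show False using S(2) t by linarith
qed

lemma k_connected_cycle_power:
  assumes t: "0 \<le> t" and k: "int k \<le> 2 * t" "int k < m"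
  shows "k_connected k (cycle_power m t)"
proof -
  have "Digraph_Component.connected
          (induce_subgraph (with_proj (cycle_power m t)) ({0..<m} - S))"
    if S: "S \<subseteq> {0..<m}" "card S < k" for S
  proof -
    let ?V = "{0..<m} - S"
    let ?H = "mk_symmetric (induce_subgraph (with_proj (cycle_power m t)) ?V)"
    have verts: "pverts ?H = ?V"
      by (simp add: mk_symmetric_def)
    have arcs: "parcs ?H = {(x, y). x \<in> ?V \<and> y \<in> ?V \<and>
        ((x, y) \<in> parcs (cycle_power m t) \<or> (y, x) \<in> parcs (cycle_power m t))}"
      unfolding mk_symmetric_def by fastforce
    have reach: "(x, y) \<in> rtrancl_on ?V (parcs ?H)"
      if "(x, y) \<in> rtrancl_on ?V (parcs (cycle_power m t))" for x y
      using that
    proof (induction rule: rtrancl_on_induct)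
      case (step y z)
      then have "(y, z) \<in> parcs ?H" by (auto simp: arcs)
      with step show ?case by (blast intro: rtrancl_on_into_rtrancl_on)
    qed simp
    have "sym (parcs ?H)" by (auto simp: arcs sym_def)
    then have sym: "sym (rtrancl_on ?V (parcs ?H))" by (rule rtrancl_on_sym)
    have "?V \<noteq> {}"
    proof
      assume "?V = {}"
      then have "card {0..<m} \<le> card S"
        using S(1) by (intro card_mono) (auto intro: finite_subset)
      then show False using S(2) k by simp
    qed
    moreover have "(u, v) \<in> rtrancl_on ?V (parcs ?H)" if uv: "u \<in> ?V" "v \<in> ?V" for u v
    proof -
      have less: "int (card S) < 2 * t" using S(2) k(1) by linarith
      have "(u, v) \<in> rtrancl_on ?V (parcs ?H) \<or> (v, u) \<in> rtrancl_on ?V (parcs ?H)"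
      proof (cases "u \<le> v")
        case True
        then show ?thesis
          using cycle_power_minus_walk[OF t S(1) less uv] reach by blast
      next
        case False
        then show ?thesis
          using cycle_power_minus_walk[OF t S(1) less uv(2,1)] reach by (meson linear)
      qed
      then show ?thesis using sym by (auto dest: symD)
    qed
    ultimately show ?thesis
      unfolding connected_def strongly_connected_def reachable_def
      by (simp add: verts)
  qed
  moreover have "k + 1 \<le> card (pverts (cycle_power m t))" using k by simp
  ultimately show ?thesis by (simp add: k_connected_def)
qed

lemma vertex_connectivity_cycle_power_ge:
  assumes "0 \<le> t" "int k \<le> 2 * t" "int k < m"
  shows "k \<le> vertex_connectivity (cycle_power m t)"
  unfolding vertex_connectivity_def
  by (rule Max_ge[OF finite_k_connected]) (simp add: k_connected_cycle_power[OF assms])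

section \<open>Degree\<close>

lemma max_degree_cycle_power_ge:
  assumes t: "0 \<le> t" and m: "0 < m"
  shows "min (m - 1) (2 * t) \<le> int (max_degree (cycle_power m t))"
proof -
  let ?X = "cycle_power m t"
  interpret pair_graph ?X by (rule pair_graph_cycle_power)
  define N where "N = {y \<in> {0<..<m}. y \<le> t \<or> m - t \<le> y}"
  have "Pair 0 ` N \<subseteq> out_arcs ?X 0"
    using m by (auto simp: N_def out_arcs_def cycle_power_def)
  then have "card (Pair (0::int) ` N) \<le> card (out_arcs ?X 0)"
    by (intro card_mono) auto
  then have "card N \<le> out_degree ?X 0"
    by (simp add: out_degree_def card_image inj_on_def)
  also have "out_degree ?X 0 \<le> max_degree ?X"
    unfolding max_degree_def using m by (intro Max_ge) auto
  finally have deg: "card N \<le> max_degree ?X" .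
  have "min (m - 1) (2 * t) \<le> int (card N)"
  proof (cases "2 * t \<le> m - 1")
    case True
    then have "N = {0<..t} \<union> {m - t..<m}"
      using t m by (auto simp: N_def)
    moreover have "{0<..t} \<inter> {m - t..<m} = {}" using True by auto
    ultimately have "card N = nat t + nat t" by (simp add: card_Un_disjoint)
    then show ?thesis using t by linarith
  next
    case False
    then have "N = {0<..<m}" by (auto simp: N_def)
    then show ?thesis using m by simp
  qed
  then show ?thesis using deg by linarith
qed

section \<open>The parameters of the theorem\<close>

theorem proposition4p5:
  fixes r n a b t :: int and X :: "int pair_pre_digraph"
  assumes "r > 6"
    and "3 * r + 3 \<le> n" and "n \<le> r ^ 2"
    and "a = n - 2 * r + 1" and "b = 2 * r - 1"
    and "t = Max {\<lceil>real_of_int a / real_of_int (r - 1)\<rceil> - 1,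
                  \<lceil>real_of_int (a - b) / 2\<rceil>,
                  \<lceil>real_of_int (r + 2) / 2\<rceil>}"
    and "2 * t \<le> b"
    and "X = cycle_power a t"
  shows "int (independence_number X) \<le> r - 1
           \<and> int (vertex_connectivity X) \<ge> a - b
           \<and> int (max_degree X) \<ge> r + 2"
proof (intro conjI)
  have t1: "\<lceil>real_of_int a / real_of_int (r - 1)\<rceil> \<le> t + 1"
    and t2: "\<lceil>real_of_int (a - b) / 2\<rceil> \<le> t"
    and t3: "\<lceil>real_of_int (r + 2) / 2\<rceil> \<le> t"
    using assms(6) by auto
  have "real_of_int a / real_of_int (r - 1) \<le> real_of_int (t + 1)"
    using t1 by (simp only: ceiling_le_iff)
  then have "real_of_int a \<le> real_of_int (t + 1) * real_of_int (r - 1)"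
    using assms(1) by (simp add: pos_divide_le_eq)
  then have indep: "a \<le> (r - 1) * (t + 1)"
    by (simp only: of_int_mult[symmetric] of_int_le_iff mult.commute)
  have double: "c \<le> 2 * t" if "\<lceil>real_of_int c / 2\<rceil> \<le> t" for c
    using that unfolding ceiling_le_iff by linarith
  have conn: "a - b \<le> 2 * t" using t2 by (rule double)
  have deg: "r + 2 \<le> 2 * t" using t3 by (rule double)
  have t: "0 \<le> t" using deg assms(1) by linarith
  show "int (independence_number X) \<le> r - 1"
    using independence_number_cycle_power_le[OF t _ indep] assms(1,8) by simp
  show "a - b \<le> int (vertex_connectivity X)"
  proof -
    have "nat (a - b) \<le> vertex_connectivity X"
      unfolding assms(8)
      by (rule vertex_connectivity_cycle_power_ge) (use t conn assms in auto)
    then show ?thesis by linarith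
  qed
  have "r + 3 \<le> a - 1" using assms(2,4) by linarith
  then show "r + 2 \<le> int (max_degree X)"
    using max_degree_cycle_power_ge[OF t, of a] deg assms(1,8) by simp
qed

end
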